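(* Let $p$ be a (sufficiently large) prime, let $N$ be a positive integer with $N<p^{3/5}$, and let $$\mathcal A_N\mathcal A_N=\{m!\,n! \bmod p:\ 1\leqslant m,n\leqslant N\}.$$ Then $|\mathcal A_N\mathcal A_N|\gg N^{1-o(1)}$; that is, for every $\varepsilon>0$ there is a constant $c(\varepsilon)>0$, independent of $p$ and $N$, such that $|\mathcal A_N\mathcal A_N|\geqslant c(\varepsilon)N^{1-\varepsilon}$.
   Context: $|X|$ denotes the cardinality of a set $X$; residues $m!n!$ are taken in $\mathbb F_p$. *)

theory Defs
  imports Complex_Main "HOL-Computational_Algebra.Primes"
begin

text \<open>Elements of the prime field of order \<open>p\<close> are represented by their least nonnegative
  residues, so that counting field elements is counting residues in \<open>{0..<p}\<close>.\<close>

definition factorial_products :: "nat \<Rightarrow> nat \<Rightarrow> nat set" where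
  "factorial_products p N = {(fact m * fact n) mod p | m n. m \<in> {1..N} \<and> n \<in> {1..N}}"

end

theory Submission
  imports Defs "HOL-Number_Theory.Cong" "HOL-Analysis.Convex"
begin

text \<open>
  Let \<open>A\<close> be the set of factorials modulo \<open>p\<close>, \<open>X = A A\<close>, and let \<open>P\<close> be the number of primes up
  to \<open>N\<close>. Two distinct primes \<open>q, q' \<le> N\<close> with a prescribed ratio modulo \<open>p\<close> can be chosen in
  at most \<open>6 K\<close> ways, where \<open>K = max 1 (N\<^sup>2 / p)\<close>: they are lattice points of a square, any two of
  which span a determinant divisible by \<open>p\<close>. By the Cauchy--Schwarz inequality, the two maps
  \<open>(q, b) \<mapsto> ((q - 1)!, q! b) \<in> A \<times> X\<close> and \<open>(q, b) \<mapsto> (q - 1)! b \<in> X\<close> on pairs of a prime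
  \<open>q \<le> N\<close> and some \<open>b \<in> A\<close> have many collisions, and the ratio bound limits these collisions:
  \<open>P\<^sup>2 \<le> |X| (P + 6 K |A|)\<close> and \<open>P\<^sup>2 |A|\<^sup>2 \<le> |X| (P |A| + 6 K |X|\<^sup>2)\<close>. The first inequality is
  strong when \<open>A\<close> is small, the second when \<open>A\<close> is large; eliminating \<open>|A|\<close> gives \<open>P \<le> 2 |X|\<close> or
  \<open>P ^ 6 \<le> 1728 K\<^sup>3 |X| ^ 5\<close>. Now \<open>K\<^sup>3 \<le> N\<close> holds exactly because \<open>N \<le> p\<close> to the power \<open>3/5\<close>,
  and \<open>P\<close> is \<open>N\<close> up to a logarithm by Chebyshev's estimate.
\<close>

section \<open>Chebyshev's lower bound for the number of primes\<close>

text \<open>The recurrence of the Leibniz harmonic triangle, which makes every entry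
  \<open>1 / (k * (n choose k))\<close> an integer combination of \<open>1 / j\<close> with \<open>j \<le> n\<close>.\<close>

lemma inverse_mult_binomial_Suc:
  assumes "1 \<le> k" "k < n"
  shows "1 / (real (Suc k) * real (n choose Suc k)) =
    1 / (real k * real (n - 1 choose k)) - 1 / (real k * real (n choose k))"
proof -
  obtain m where n: "n = Suc m" using assms by (cases n) auto
  have km: "k \<le> m" using assms n by simp
  define x where "x = real (m choose k)"
  have x: "x > 0" using km by (simp add: x_def)
  have 1: "real (Suc k) * real (n choose Suc k) = real n * x"
    using Suc_times_binomial_eq[of m k] unfolding x_def n by (metis mult.commute of_nat_mult)
  have "(n - k) * (n choose k) = n * (m choose k)"
    using binomial_absorb_comp[of n k] n by simp
  then have 2: "real (n - k) * real (n choose k) = real n * x"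
    unfolding x_def by (metis of_nat_mult)
  have nk: "real (n - k) > 0" "real (n - k) = real n - real k" "real k > 0" using assms by auto
  have 3: "real (n choose k) = real n * x / real (n - k)" using 2 nk by (simp add: field_simps)
  have "1 / (r * x) = 1 / (s * x) - 1 / (s * (r * x / (r - s)))"
    if "s > 0" "r - s > 0" for r s
    using that x by (simp add: divide_simps)
  from this[of "real k" "real n"] show ?thesis unfolding 1 3 using nk n by (simp add: x_def)
qed

text \<open>After multiplication by \<open>M\<close>, the triangle recurrence writes each entry of
  column \<open>k + 1\<close> as a difference of two entries of column \<open>k\<close>. The first
  column consists of the integers \<open>M / n\<close>, so induction on \<open>k\<close> makes every
  entry an integer.\<close>

lemma mult_binomial_dvd:
  assumes M: "\<And>j. 1 \<le> j \<Longrightarrow> j \<le> N \<Longrightarrow> j dvd M"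
    and "1 \<le> k" "k \<le> N"
  shows "k * (N choose k) dvd M"
proof -
  have *: "real M / (real k * real (n choose k)) \<in> \<int>" if "1 \<le> k" "k \<le> n" "n \<le> N" for k n
    using that
  proof (induction k arbitrary: n rule: nat_induct_at_least)
    case base
    then obtain c where "M = n * c" using M[of n] by (auto elim: dvdE)
    then show ?case using base by simp
  next
    case (Suc k)
    have "real M / (real (Suc k) * real (n choose Suc k)) =
        real M / (real k * real (n - 1 choose k)) - real M / (real k * real (n choose k))"
      using inverse_mult_binomial_Suc[of k n] Suc.prems Suc.hyps
      by (metis (no_types, lifting) Suc_le_eq mult.right_neutral right_diff_distrib times_divide_eq_right)
    moreover have "real M / (real k * real (n - 1 choose k)) \<in> \<int>"
      "real M / (real k * real (n choose k)) \<in> \<int>"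
      using Suc by (auto intro!: Suc.IH)
    ultimately show ?case by simp
  qed
  have "real M / real (k * (N choose k)) \<in> \<int>" using *[of k N] assms by simp
  then obtain z where z: "real M / real (k * (N choose k)) = of_int z" by (auto elim: Ints_cases)
  have "k * (N choose k) > 0" using assms by simp
  then have "real M = of_int (z * int (k * (N choose k)))"
    using z by (simp add: field_simps del: of_nat_mult)
  then have "int M = z * int (k * (N choose k))" by linarith
  then show ?thesis by (metis dvd_triv_right int_dvd_int_iff)
qed

text \<open>The witness is the least common multiple of \<open>1..n\<close> in factored form: every
  prime \<open>q \<le> n\<close> enters with its largest exponent in any \<open>j \<le> n\<close>,
  and such a prime power divides that \<open>j\<close>, hence is at most \<open>n\<close>.\<close>

lemma common_multiple_le_power:
  fixes n :: nat
  obtains M where "M > 0" "\<And>j. 1 \<le> j \<Longrightarrow> j \<le> n \<Longrightarrow> j dvd M"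
    "M \<le> n ^ card {q. prime q \<and> q \<le> n}"
proof -
  define P where "P = {q::nat. prime q \<and> q \<le> n}"
  define e where "e q = Max (multiplicity q ` {1..n})" for q :: nat
  define M where "M = (\<Prod>q\<in>P. q ^ e q)"
  have fin: "finite P" unfolding P_def by simp
  have prm: "prime q" if "q \<in> P" for q using that by (simp add: P_def)
  have M0: "M > 0" unfolding M_def using prm by (auto intro!: prod_pos simp: prime_gt_0_nat)
  have "j dvd M" if j: "1 \<le> j" "j \<le> n" for j
  proof (rule multiplicity_le_imp_dvd)
    fix q :: nat assume q: "prime q"
    show "multiplicity q j \<le> multiplicity q M"
    proof (cases "q dvd j")
      case True
      then have "q \<in> P" using q j dvd_imp_le[of q j] by (auto simp: P_def)
      then have "multiplicity q M = e q"
        unfolding M_def using fin prm by (subst multiplicity_prod_prime_powers) auto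
      moreover have "multiplicity q j \<le> e q" unfolding e_def using j by (intro Max_ge) auto
      ultimately show ?thesis by simp
    qed (simp add: not_dvd_imp_multiplicity_0)
  qed (use j in auto)
  moreover have "M \<le> n ^ card P"
  proof -
    have "q ^ e q \<le> n" if "q \<in> P" for q
    proof -
      have "n \<ge> 1" using that prime_gt_0_nat[of q] by (auto simp: P_def)
      then have "e q \<in> multiplicity q ` {1..n}" unfolding e_def by (intro Max_in) auto
      then obtain j where j: "j \<in> {1..n}" "e q = multiplicity q j" by blast
      have "q ^ e q dvd j" using j multiplicity_dvd by metis
      then show ?thesis using j dvd_imp_le[of "q ^ e q" j] by auto
    qed
    then have "M \<le> (\<Prod>q\<in>P. n)" unfolding M_def by (intro prod_mono) auto
    then show ?thesis by simp
  qed
  ultimately show ?thesis using that[of M] M0 unfolding P_def by blast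
qed

text \<open>The common multiple is bounded above by the number of primes; it is bounded below
  because \<open>k\<close> times the central binomial coefficient of \<open>2 * k\<close> divides
  it, and that product is at least \<open>4 ^ k / 2\<close>.\<close>

lemma two_power_le_power_card_primes:
  assumes "n \<ge> 2"
  shows "2 ^ (n - 2) \<le> n ^ card {q::nat. prime q \<and> q \<le> n}"
proof -
  obtain M where M: "M > 0" "\<And>j. 1 \<le> j \<Longrightarrow> j \<le> n \<Longrightarrow> j dvd M"
    "M \<le> n ^ card {q::nat. prime q \<and> q \<le> n}"
    using common_multiple_le_power by blast
  \<comment> \<open>For odd \<open>n\<close> the halving loses one, which is why the exponent is
    \<open>n - 2\<close>.\<close>
  define k where "k = n div 2"
  have k: "1 \<le> k" "2 * k \<le> n" "n - 2 \<le> 2 * k - 1" using assms by (auto simp: k_def)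
  have "k * (2 * k choose k) dvd M" using M k by (intro mult_binomial_dvd) auto
  then have le: "k * (2 * k choose k) \<le> M" using M by (auto intro: dvd_imp_le)
  have "4 ^ k / (2 * real k) \<le> real (2 * k choose k)"
    using central_binomial_lower_bound[of k] k by simp
  then have "4 ^ k \<le> 2 * real (k * (2 * k choose k))" using k by (simp add: field_simps)
  then have "real (4 ^ k) \<le> real (2 * (k * (2 * k choose k)))" by simp
  then have "4 ^ k \<le> 2 * (k * (2 * k choose k))" by (simp only: of_nat_le_iff)
  moreover have "(4::nat) ^ k = 2 * 2 ^ (2 * k - 1)"
    using k by (simp add: power_mult power_Suc[symmetric] del: power_Suc)
  ultimately have "2 ^ (2 * k - 1) \<le> M" using le by linarith
  moreover have "(2::nat) ^ (n - 2) \<le> 2 ^ (2 * k - 1)" using k by (intro power_increasing) auto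
  ultimately show ?thesis using M by linarith
qed

text \<open>Logarithms turn the previous bound into one of order \<open>n / ln n\<close>, and
  \<open>ln n\<close> is at most \<open>n powr \<delta> / \<delta>\<close>.\<close>

lemma card_primes_ge_powr:
  fixes \<delta> :: real
  assumes "0 < \<delta>" "\<delta> \<le> 1"
  obtains c where "0 < c" "c \<le> 1"
    "\<And>n. n \<ge> 2 \<Longrightarrow> c * real n powr (1 - \<delta>) \<le> real (card {q::nat. prime q \<and> q \<le> n})"
proof -
  \<comment> \<open>The factor 1/4 comes from \<open>n - 2 \<ge> n / 2\<close> and
    \<open>ln 2 \<ge> 1 / 2\<close> when \<open>n \<ge> 4\<close>; for smaller \<open>n\<close> it
    pushes the left side below 1, which the prime 2 already provides.\<close>
  define c where "c = \<delta> / 4"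
  have "c * real n powr (1 - \<delta>) \<le> real (card {q::nat. prime q \<and> q \<le> n})" if n: "n \<ge> 2" for n
  proof -
    define P where "P = card {q::nat. prime q \<and> q \<le> n}"
    have "2 \<in> {q::nat. prime q \<and> q \<le> n}" using n by simp
    moreover have "finite {q::nat. prime q \<and> q \<le> n}" by simp
    ultimately have "P > 0" unfolding P_def card_gt_0_iff by blast
    then have P1: "P \<ge> 1" by simp
    have pr: "real n powr (1 - \<delta>) = real n / real n powr \<delta>" using n by (simp add: powr_diff)
    have n\<delta>: "real n powr \<delta> \<ge> 1" using n assms by (simp add: ge_one_powr_ge_zero)
    show ?thesis unfolding P_def[symmetric]
    proof (cases "n \<ge> 4")
      case False
      have "real n powr (1 - \<delta>) \<le> real n" using powr_mono[of "1 - \<delta>" 1 "real n"] n assms by simp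
      then have "c * real n powr (1 - \<delta>) \<le> (1/4) * 4"
        using False assms unfolding c_def by (intro mult_mono) auto
      then show "c * real n powr (1 - \<delta>) \<le> real P" using P1 by simp
    next
      case True
      have "real (2 ^ (n - 2)) \<le> real (n ^ P)"
        using two_power_le_power_card_primes[OF n] unfolding P_def by (simp only: of_nat_le_iff)
      then have "ln ((2::real) ^ (n - 2)) \<le> ln (real n ^ P)" using n by (subst ln_le_cancel_iff) auto
      then have "real (n - 2) * ln 2 \<le> real P * ln (real n)" using n by (simp add: ln_realpow)
      moreover have "real (n - 2) \<ge> real n / 2" using True by (simp add: of_nat_diff)
      moreover have "ln (2::real) \<ge> 1/2" using ln_le_minus_one[of "1/2::real"] by (simp add: ln_div)
      moreover have "ln (real n) \<le> real n powr \<delta> / \<delta>" using ln_powr_bound[of "real n" \<delta>] n assms by simp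
      moreover have "real n / 2 * (1/2) \<le> real (n - 2) * ln 2"
        using calculation by (intro mult_mono) auto
      moreover have "real P * ln (real n) \<le> real P * (real n powr \<delta> / \<delta>)"
        using calculation by (intro mult_left_mono) auto
      ultimately have "real n / 4 \<le> real P * (real n powr \<delta> / \<delta>)" by linarith
      then show "c * real n powr (1 - \<delta>) \<le> real P"
        unfolding pr c_def using n\<delta> assms by (simp add: divide_simps mult.commute)
    qed
  qed
  then show ?thesis using that[of c] assms by (auto simp: c_def)
qed

section \<open>Cauchy-Schwarz and counting by fibres\<close>

text \<open>Cauchy-Schwarz for the fibre sizes of \<open>f\<close>: they sum to
  \<open>card Z\<close>, and their squares sum to the number of colliding pairs.\<close>

lemma card_square_le_card_collisions:
  assumes "finite Z" "finite Y" "f ` Z \<subseteq> Y"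
  shows "real (card Z) ^ 2 \<le> real (card Y) * real (card {(z, z'). z \<in> Z \<and> z' \<in> Z \<and> f z = f z'})"
proof -
  define F where "F y = {z \<in> Z. f z = y}" for y
  have fF: "finite (F y)" for y using assms by (simp add: F_def)
  have "card Z = (\<Sum>y\<in>Y. card (F y))"
    using sum.group[OF assms, of "\<lambda>_. 1::nat"] by (simp add: F_def)
  then have Z: "real (card Z) = (\<Sum>y\<in>Y. real (card (F y)))" by simp
  have "{(z, z'). z \<in> Z \<and> z' \<in> Z \<and> f z = f z'} = (\<Union>y\<in>Y. F y \<times> F y)"
    using assms by (auto simp: F_def)
  moreover have "card (\<Union>y\<in>Y. F y \<times> F y) = (\<Sum>y\<in>Y. card (F y \<times> F y))"
    using assms fF by (intro card_UN_disjoint) (auto simp: F_def)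
  ultimately have "real (card {(z, z'). z \<in> Z \<and> z' \<in> Z \<and> f z = f z'}) = (\<Sum>y\<in>Y. real (card (F y)) ^ 2)"
    by (simp add: card_cartesian_product power2_eq_square)
  then show ?thesis
    using sum_squared_le_sum_of_squares[of "\<lambda>y. real (card (F y))" Y] Z by (simp add: mult.commute)
qed

lemma card_le_card_mult_fibre:
  fixes c :: real
  assumes "finite T" "finite Y" "g ` T \<subseteq> Y"
    and fib: "\<And>y. y \<in> Y \<Longrightarrow> real (card {t \<in> T. g t = y}) \<le> c"
  shows "real (card T) \<le> c * real (card Y)"
proof -
  have "card T = (\<Sum>y\<in>Y. card {t \<in> T. g t = y})"
    using sum.group[OF assms(1-3), of "\<lambda>_. 1::nat"] by simp
  then have "real (card T) = (\<Sum>y\<in>Y. real (card {t \<in> T. g t = y}))" by simp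
  also have "\<dots> \<le> (\<Sum>y\<in>Y. c)" using fib by (intro sum_mono) auto
  finally show ?thesis by (simp add: mult.commute)
qed

section \<open>Pairs of primes with a prescribed ratio modulo \<open>p\<close>\<close>

text \<open>All pairs are compared with one reference pair \<open>(a, b)\<close>: the determinant
  \<open>a * s - b * r\<close> is a multiple of \<open>p\<close> of absolute value at most
  \<open>a * N\<close>, as \<open>b < a\<close>. This limits the determinants, and each of them
  leaves few choices of \<open>r\<close>.\<close>

lemma card_proportional_prime_pairs_le_aux:
  fixes p N a b :: nat
  assumes p: "p > 0"
    and S: "S \<subseteq> {(r, s). prime r \<and> prime s \<and> r \<le> N \<and> s \<le> N}"
    and ab: "(a, b) \<in> S" "b < a"
    and cg: "\<And>r s. (r, s) \<in> S \<Longrightarrow> [int a * int s = int b * int r] (mod int p)"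
  shows "real (card S) \<le> 6 * max 1 (real N ^ 2 / real p)"
proof -
  have pr: "prime a" "prime b" "a \<le> N" "b \<le> N" using ab S by auto
  have cop: "coprime a b" using pr ab by (simp add: primes_coprime)
  have a0: "a > 0" using pr prime_gt_0_nat by blast
  define h where "h r s = (int a * int s - int b * int r) div int p" for r s
  have h: "int a * int s - int b * int r = h r s * int p" if "(r, s) \<in> S" for r s
    using cg[OF that] unfolding h_def by (simp add: cong_iff_dvd_diff)
  define B where "B = (a * N) div p"
  have hB: "h r s \<in> {- int B..int B}" if rs: "(r, s) \<in> S" for r s
  proof -
    have "r \<le> N" "s \<le> N" using rs S by auto
    then have "a * s \<le> a * N" "b * r \<le> a * N" using ab by (auto intro: mult_mono)
    then have "int (a * s) \<le> int (a * N)" "int (b * r) \<le> int (a * N)"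
      by (simp_all only: of_nat_le_iff)
    then have "\<bar>int a * int s - int b * int r\<bar> \<le> int (a * N)"
      by (smt (verit) of_nat_0_le_iff of_nat_mult)
    then have "\<bar>h r s\<bar> * int p \<le> int (a * N)" using h[OF rs] by (simp add: abs_mult)
    then have "\<bar>h r s\<bar> \<le> int (a * N) div int p"
      using p zdiv_mono1[of "\<bar>h r s\<bar> * int p" "int (a * N)" "int p"] by simp
    then show ?thesis by (auto simp: B_def zdiv_int)
  qed
  show ?thesis
  proof (cases "a * N < p")
    \<comment> \<open>Every determinant is zero here, so \<open>r / s = a / b\<close>; for primes
      this forces \<open>(r, s) = (a, b)\<close>.\<close>
    case True
    then have B: "B = 0" by (simp add: B_def)
    have "S \<subseteq> {(a, b)}"
    proof (clarify)
      fix r s assume rs: "(r, s) \<in> S"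
      have "h r s = 0" using hB[OF rs] B by simp
      then have "int (a * s) = int (b * r)" using h[OF rs] by simp
      then have eq: "a * s = b * r" by (simp only: of_nat_eq_iff)
      have "prime r" "prime s" using rs S by auto
      have "a dvd r" using eq cop by (metis coprime_dvd_mult_right_iff dvd_triv_left)
      then have "a = r" using \<open>prime r\<close> pr by (simp add: primes_dvd_imp_eq)
      moreover from this have "s = b" using eq a0 by (simp add: mult.commute)
      ultimately show "r = a \<and> s = b" by simp
    qed
    then have "card S \<le> 1" using card_mono[of "{(a, b)}" S] by simp
    then show ?thesis by simp
  next
    case False
    \<comment> \<open>For a fixed determinant, coprimality of \<open>a\<close> and \<open>b\<close>
      fixes \<open>r\<close> modulo \<open>a\<close>; the quotient \<open>r div a\<close> then fixes
      \<open>r\<close>, and \<open>s\<close> follows.\<close>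
    define g where "g = (\<lambda>(r, s). (h r s, r div a))"
    have "inj_on g S"
    proof (rule inj_onI, clarify)
      fix r s r' s' assume rs: "(r, s) \<in> S" "(r', s') \<in> S" and "g (r, s) = g (r', s')"
      then have g: "h r s = h r' s'" "r div a = r' div a" by (auto simp: g_def)
      have "int a * int s - int b * int r = int a * int s' - int b * int r'"
        using h[OF rs(1)] h[OF rs(2)] g by simp
      then have eq: "int a * (int s - int s') = int b * (int r - int r')" by (simp add: algebra_simps)
      then have "int a dvd int b * (int r - int r')" by (metis dvd_triv_left)
      then have "int a dvd int r - int r'" using cop by (simp add: coprime_dvd_mult_right_iff)
      then have "int r mod int a = int r' mod int a" by (simp only: mod_eq_dvd_iff)
      then have "r mod a = r' mod a" by (simp only: of_nat_mod[symmetric] of_nat_eq_iff)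
      then have "r = r'" using g by (metis div_mult_mod_eq)
      then show "r = r' \<and> s = s'" using eq a0 by simp
    qed
    moreover have "g ` S \<subseteq> {- int B..int B} \<times> {0..N div a}"
      using hB S by (auto simp: g_def intro!: div_le_mono)
    ultimately have "card S \<le> card ({- int B..int B} \<times> {0..N div a})"
      by (intro card_inj_on_le) auto
    also have "\<dots> = (2 * B + 1) * (N div a + 1)" by (simp add: card_cartesian_product nat_add_distrib nat_mult_distrib)
    finally have "real (card S) \<le> real ((2 * B + 1) * (N div a + 1))" by (simp only: of_nat_le_iff)
    then have c: "real (card S) \<le> (2 * real B + 1) * (real (N div a) + 1)"
      by (simp only: of_nat_mult of_nat_add of_nat_1 of_nat_numeral)
    \<comment> \<open>Since \<open>p \<le> a * N\<close> and \<open>a \<le> N\<close>, the added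
      ones are absorbed at the cost of the factors 3 and 2. The unknown \<open>a\<close> cancels in
      the product of the two bounds.\<close>
    have "real B \<le> real (a * N) / real p" unfolding B_def by (rule of_nat_div_le_of_nat)
    moreover have "1 \<le> real (a * N) / real p" using False p by (simp add: field_simps flip: of_nat_mult)
    ultimately have c1: "2 * real B + 1 \<le> 3 * (real (a * N) / real p)" by argo
    have "real (N div a) \<le> real N / real a" by (rule of_nat_div_le_of_nat)
    moreover have "1 \<le> real N / real a" using pr a0 by simp
    ultimately have c2: "real (N div a) + 1 \<le> 2 * (real N / real a)" by argo
    have "real (card S) \<le> 3 * (real (a * N) / real p) * (2 * (real N / real a))"
      using c mult_mono[OF c1 c2] by simp
    also have "\<dots> = 6 * (real N ^ 2 / real p)" using a0 by (simp add: power2_eq_square)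
    also have "\<dots> \<le> 6 * max 1 (real N ^ 2 / real p)" by simp
    finally show ?thesis .
  qed
qed

text \<open>Multiplying the congruences of two pairs crosswise and cancelling the unit
  \<open>u * v\<close> leaves one in the primes alone. As the members of a pair differ, the larger
  one of the reference pair can be put first, by swapping all pairs if necessary.\<close>

lemma card_proportional_prime_pairs_le:
  fixes p N u v :: nat
  assumes p: "prime p" and uv: "coprime u p" "coprime v p"
    and S: "S \<subseteq> {(r, s). prime r \<and> prime s \<and> r \<le> N \<and> s \<le> N \<and> r \<noteq> s \<and> [r * u = s * v] (mod p)}"
  shows "real (card S) \<le> 6 * max 1 (real N ^ 2 / real p)"
proof (cases "S = {}")
  case False
  have p0: "p > 0" using p prime_gt_0_nat by blast
  from False obtain a b where ab: "(a, b) \<in> S" by auto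
  have cg: "[a * s = b * r] (mod p)" if "(r, s) \<in> S" for r s
  proof -
    have "[a * u = b * v] (mod p)" "[r * u = s * v] (mod p)" using ab that S by auto
    then have "[(a * u) * (s * v) = (b * v) * (r * u)] (mod p)" by (blast intro: cong_mult cong_sym)
    then have "[(a * s) * (u * v) = (b * r) * (u * v)] (mod p)" by (simp add: ac_simps)
    then show ?thesis using uv by (subst (asm) cong_mult_rcancel_nat) auto
  qed
  then have cgi: "[int a * int s = int b * int r] (mod int p)" if "(r, s) \<in> S" for r s
    using that by (simp add: cong_int_iff flip: of_nat_mult)
  have "a \<noteq> b" using ab S by auto
  then consider "b < a" | "a < b" by linarith
  then show ?thesis
  proof cases
    case 1
    then show ?thesis using ab S p0 cgi by (intro card_proportional_prime_pairs_le_aux[where a=a and b=b]) auto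
  next
    case 2
    have "real (card (prod.swap ` S)) \<le> 6 * max 1 (real N ^ 2 / real p)"
      using ab S p0 cgi 2
      by (intro card_proportional_prime_pairs_le_aux[where a=b and b=a]) (auto intro: cong_sym)
    then show ?thesis by (simp add: card_image)
  qed
qed simp

section \<open>Collisions of maps on pairs of a prime and a residue\<close>

text \<open>Common frame for both collision counts. Collisions with \<open>q = q'\<close> are
  trivial, giving at most \<open>card Q * card A\<close>. The others are sorted by a label
  \<open>g\<close>: each label prescribes the ratio of \<open>q\<close> and \<open>q'\<close> modulo
  \<open>p\<close>, and label and primes together determine \<open>b\<close> and
  \<open>b'\<close>.\<close>

lemma card_collisions_le:
  fixes p N :: nat and A :: "nat set" and Q :: "nat set"
    and g :: "nat \<times> nat \<Rightarrow> nat \<times> nat \<Rightarrow> 'a"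
  assumes p: "prime p"
    and Q: "Q \<subseteq> {q. prime q \<and> q \<le> N}" and A: "finite A"
    and T: "T \<subseteq> (Q \<times> A) \<times> (Q \<times> A)"
    and Y: "finite Y" "\<And>z z'. (z, z') \<in> T \<Longrightarrow> g z z' \<in> Y"
    and diag: "\<And>q b b'. ((q, b), (q, b')) \<in> T \<Longrightarrow> b = b'"
    and cong: "\<And>y. y \<in> Y \<Longrightarrow> \<exists>u v. coprime u p \<and> coprime v p \<and>
      (\<forall>q b q' b'. ((q, b), (q', b')) \<in> T \<longrightarrow> g (q, b) (q', b') = y \<longrightarrow> [q * u = q' * v] (mod p))"
    and inj: "\<And>q b q' b' c c'. ((q, b), (q', b')) \<in> T \<Longrightarrow> ((q, c), (q', c')) \<in> T \<Longrightarrow>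
      g (q, b) (q', b') = g (q, c) (q', c') \<Longrightarrow> b = c \<and> b' = c'"
  shows "real (card T) \<le> real (card Q) * real (card A)
    + 6 * max 1 (real N ^ 2 / real p) * real (card Y)"
proof -
  define Z where "Z = Q \<times> A"
  have "finite Q" using Q finite_subset[of Q "{..N}"] by auto
  then have finZ: "finite Z" using A by (simp add: Z_def)
  define D where "D = {t \<in> T. fst (fst t) = fst (snd t)}"
  define E where "E = {t \<in> T. fst (fst t) \<noteq> fst (snd t)}"
  have finT: "finite T" using T finZ finite_subset unfolding Z_def by blast
  have "T = D \<union> E" "D \<inter> E = {}" by (auto simp: D_def E_def)
  then have card: "card T = card D + card E" using finT by (metis card_Un_disjoint finite_Un)
  have "t \<in> (\<lambda>z. (z, z)) ` Z" if "t \<in> D" for t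
  proof -
    obtain q b q' b' where t: "t = ((q, b), (q', b'))" by (metis prod.collapse)
    then have qT: "q' = q" "((q, b), (q, b')) \<in> T" using that by (auto simp: D_def)
    then have "b' = b" "(q, b) \<in> Z" using diag[OF qT(2)] T by (auto simp: Z_def)
    then show ?thesis using t qT by blast
  qed
  then have "card D \<le> card Z" using finZ by (meson subsetI card_image_le card_mono finite_imageI le_trans)
  then have 1: "real (card D) \<le> real (card Q) * real (card A)"
    by (simp add: Z_def card_cartesian_product flip: of_nat_mult)
  have 2: "real (card E) \<le> 6 * max 1 (real N ^ 2 / real p) * real (card Y)"
  proof (rule card_le_card_mult_fibre[where g = "\<lambda>(z, z'). g z z'"])
    fix y assume "y \<in> Y"
    then obtain u v where uv: "coprime u p" "coprime v p"
      "\<And>q b q' b'. ((q, b), (q', b')) \<in> T \<Longrightarrow> g (q, b) (q', b') = y \<Longrightarrow> [q * u = q' * v] (mod p)"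
      using cong by metis
    define F where "F = {t \<in> E. (case t of (z, z') \<Rightarrow> g z z') = y}"
    define \<pi> :: "(nat \<times> nat) \<times> (nat \<times> nat) \<Rightarrow> nat \<times> nat"
      where "\<pi> = (\<lambda>(z, z'). (fst z, fst z'))"
    have F: "((q, b), (q', b')) \<in> T" "q \<noteq> q'" "g (q, b) (q', b') = y" "q \<in> Q" "q' \<in> Q"
      if "((q, b), (q', b')) \<in> F" for q b q' b'
      using that T by (auto simp: F_def E_def)
    have "inj_on \<pi> F"
    proof (rule inj_onI)
      fix s t assume st: "s \<in> F" "t \<in> F" and eq: "\<pi> s = \<pi> t"
      obtain q b q' b' where s: "s = ((q, b), (q', b'))" by (metis prod.collapse)
      obtain c c' where t: "t = ((q, c), (q', c'))" using eq s by (cases t) (auto simp: \<pi>_def)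
      have "((q, b), (q', b')) \<in> F" "((q, c), (q', c')) \<in> F" using st s t by auto
      then show "s = t" using inj[of q b q' b' c c'] F s t by simp
    qed
    then have "card F = card (\<pi> ` F)" by (simp add: card_image)
    also have "real (card (\<pi> ` F)) \<le> 6 * max 1 (real N ^ 2 / real p)"
    proof (rule card_proportional_prime_pairs_le[OF p uv(1,2)], clarify)
      fix r s q b q' b' assume F': "((q, b), (q', b')) \<in> F" and "(r, s) = \<pi> ((q, b), (q', b'))"
      then have "r = q" "s = q'" by (auto simp: \<pi>_def)
      then show "prime r \<and> prime s \<and> r \<le> N \<and> s \<le> N \<and> r \<noteq> s \<and> [r * u = s * v] (mod p)"
        using F[OF F'] uv(3) Q by blast
    qed
    finally show "real (card {t \<in> E. (case t of (z, z') \<Rightarrow> g z z') = y}) \<le> 6 * max 1 (real N ^ 2 / real p)"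
      unfolding F_def .
  qed (use finT Y in \<open>auto simp: E_def\<close>)
  show ?thesis using 1 2 card by simp
qed

section \<open>The two collision inequalities and the elimination of \<open>card A\<close>\<close>

lemma factorial_products_dichotomy:
  fixes p N :: nat
  defines "P \<equiv> real (card {q. prime q \<and> q \<le> N})"
    and "X \<equiv> real (card (factorial_products p N))"
    and "K \<equiv> max 1 (real N ^ 2 / real p)"
  assumes p: "prime p" and N: "0 < N" "N < p"
  shows "P \<le> 2 * X \<or> P ^ 6 \<le> 1728 * K ^ 3 * X ^ 5"
proof -
  define Q where "Q = {q. prime q \<and> q \<le> N}"
  define A where "A = (\<lambda>n. fact n mod p) ` {1..N}"
  define XX where "XX = factorial_products p N"
  define a where "a = real (card A)"
  define Z where "Z = Q \<times> A"
  have p0: "p > 0" using p prime_gt_0_nat by blast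
  have finQ: "finite Q" unfolding Q_def by simp
  have finA: "finite A" unfolding A_def by simp
  have finZ: "finite Z" unfolding Z_def using finQ finA by simp
  have XXim: "XX = (\<lambda>(m, n). (fact m * fact n) mod p) ` ({1..N} \<times> {1..N})"
    unfolding XX_def factorial_products_def by (auto simp: image_iff) blast
  have finX: "finite XX" unfolding XXim by simp
  have cop: "coprime (fact m) p" if "m \<le> N" for m
    using that N p by (simp add: prime_dvd_fact_iff coprime_commute prime_imp_coprime)
  have copA: "coprime b p" "b < p" if "b \<in> A" for b
    using that cop p0 by (auto simp: A_def)
  have copX: "coprime x p" if "x \<in> XX" for x
    using that cop p0 unfolding XXim by auto
  have inX: "(fact m * b) mod p \<in> XX" if "1 \<le> m" "m \<le> N" "b \<in> A" for m b
    using that unfolding A_def XXim by (force simp: mod_mult_right_eq)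
  have Q2: "2 \<le> q" "q \<le> N" "1 \<le> q - 1" "q - 1 \<le> N" "prime q" if "q \<in> Q" for q
    using that prime_ge_2_nat[of q] by (auto simp: Q_def)
  have inXq: "(fact q * b) mod p \<in> XX" if "q \<in> Q" "b \<in> A" for q b
    using Q2[OF that(1)] that(2) by (intro inX) auto
  have fact_q: "fact q = q * (fact (q - 1) :: nat)" if "q \<in> Q" for q
    using Q2[OF that] by (simp add: fact_reduce)
  \<comment> \<open>Elements of \<open>A\<close> are least residues, so cancelling the unit
    \<open>fact m\<close> yields an equality, not just a congruence.\<close>
  have cancel: "b = b'" if "m \<le> N" "b \<in> A" "b' \<in> A" "[fact m * b = fact m * b'] (mod p)" for m b b'
    using that cop[of m] copA by (metis cong_less_modulus_unique_nat cong_mult_lcancel_nat)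
  have cardZ: "real (card Z) = P * a"
    by (simp add: Z_def card_cartesian_product P_def a_def Q_def)
  have P0: "P \<ge> 0" by (simp add: P_def)
  have a1: "a \<ge> 1"
  proof -
    have "A \<noteq> {}" using N by (auto simp: A_def)
    then have "card A > 0" using finA by (simp add: card_gt_0_iff)
    then show ?thesis by (simp add: a_def)
  qed
  \<comment> \<open>Collisions of \<open>(q, b) \<mapsto> ((q - 1)!, q! b)\<close> satisfy \<open>q b \<equiv> q' b'\<close>.\<close>
  have I1: "P ^ 2 \<le> X * (P + 6 * K * a)"
  proof -
    define f where "f = (\<lambda>(q, b). (fact (q - 1) mod p, (fact q * b) mod p))"
    define T where "T = {(z, z'). z \<in> Z \<and> z' \<in> Z \<and> f z = f z'}"
    have T: "q \<in> Q" "q' \<in> Q" "b \<in> A" "b' \<in> A" "[q * b = q' * b'] (mod p)"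
      if t: "((q, b), (q', b')) \<in> T" for q b q' b'
    proof -
      show q: "q \<in> Q" "q' \<in> Q" "b \<in> A" "b' \<in> A" using t by (auto simp: T_def Z_def)
      have e: "[fact (q - 1) = fact (q' - 1) :: nat] (mod p)" "[fact q * b = fact q' * b'] (mod p)"
        using t by (auto simp: T_def f_def cong_def)
      have "[fact (q - 1) * (q * b) = fact (q' - 1) * (q' * b')] (mod p)"
        using e(2) fact_q[OF q(1)] fact_q[OF q(2)] by (simp add: ac_simps)
      also have "[fact (q' - 1) * (q' * b') = fact (q - 1) * (q' * b')] (mod p)"
        using e(1) by (intro cong_mult cong_refl) (simp add: cong_sym)
      finally show "[q * b = q' * b'] (mod p)"
        using cop[OF Q2(4)[OF q(1)]] by (simp add: cong_mult_lcancel_nat)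
    qed
    have "real (card Z) ^ 2 \<le> real (card (A \<times> XX)) * real (card T)"
      unfolding T_def
    proof (rule card_square_le_card_collisions)
      show "f ` Z \<subseteq> A \<times> XX"
      proof (clarify)
        fix q b u v assume "(q, b) \<in> Z" and f: "(u, v) = f (q, b)"
        then have q: "q \<in> Q" "b \<in> A" by (auto simp: Z_def)
        have "fact (q - 1) mod p \<in> A" using Q2[OF q(1)] by (auto simp: A_def)
        moreover have "(fact q * b) mod p \<in> XX" using inXq q by blast
        ultimately show "u \<in> A \<and> v \<in> XX" using f by (simp add: f_def)
      qed
    qed (use finZ finA finX in auto)
    also have "real (card T) \<le> P * a + 6 * K * real (card (A \<times> A))"
    unfolding K_def a_def P_def Q_def[symmetric]
    \<comment> \<open>The label is the pair \<open>(b, b')\<close> itself, and its components serve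
      as \<open>u\<close> and \<open>v\<close>.\<close>
    proof (rule card_collisions_le[where A = A and g = "\<lambda>z z'. (snd z, snd z')"])
      show "T \<subseteq> (Q \<times> A) \<times> (Q \<times> A)" by (auto simp: T_def Z_def)
      show "b = b'" if "((q, b), (q, b')) \<in> T" for q b b'
      proof (rule cancel[of q])
        show "[fact q * b = fact q * b'] (mod p)" using that by (auto simp: T_def f_def cong_def)
      qed (use T[OF that] Q2 in auto)
      show "\<exists>u v. coprime u p \<and> coprime v p \<and> (\<forall>q b q' b'. ((q, b), (q', b')) \<in> T \<longrightarrow>
          (snd (q, b), snd (q', b')) = y \<longrightarrow> [q * u = q' * v] (mod p))" if "y \<in> A \<times> A" for y
        using that copA T(5) by (rule_tac exI[of _ "fst y"], rule_tac exI[of _ "snd y"]) auto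
    qed (use p T finA Q_def in auto)
    finally have "(P * a) ^ 2 \<le> a * X * (P * a + 6 * K * (a * a))"
      using cardZ by (simp add: card_cartesian_product a_def X_def XX_def mult_left_mono)
    then have "a ^ 2 * P ^ 2 \<le> a ^ 2 * (X * (P + 6 * K * a))"
      by (simp add: power2_eq_square algebra_simps)
    then show ?thesis using a1 by simp
  qed
  \<comment> \<open>For collisions of \<open>(q, b) \<mapsto> (q - 1)! b\<close>, the products \<open>y = q! b\<close> and \<open>y' = q'! b'\<close>
    satisfy \<open>q y' \<equiv> q' y\<close>.\<close>
  have I2: "(P * a) ^ 2 \<le> X * (P * a + 6 * K * X ^ 2)"
  proof -
    define f where "f = (\<lambda>(q, b). (fact (q - 1) * b) mod p)"
    define g where "g = (\<lambda>(q, b) (q', b'). ((fact q * b) mod p, (fact q' * b') mod p))"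
    define T where "T = {(z, z'). z \<in> Z \<and> z' \<in> Z \<and> f z = f z'}"
    have T: "q \<in> Q" "q' \<in> Q" "b \<in> A" "b' \<in> A" "[fact (q - 1) * b = fact (q' - 1) * b'] (mod p)"
      if t: "((q, b), (q', b')) \<in> T" for q b q' b'
      using t by (auto simp: T_def Z_def f_def cong_def)
    have "real (card Z) ^ 2 \<le> real (card XX) * real (card T)"
      unfolding T_def
    proof (rule card_square_le_card_collisions)
      show "f ` Z \<subseteq> XX" using inX Q2 by (auto simp: f_def Z_def)
    qed (use finZ finX in auto)
    also have "real (card T) \<le> P * a + 6 * K * real (card (XX \<times> XX))"
    unfolding K_def a_def P_def Q_def[symmetric]
    proof (rule card_collisions_le[where A = A and g = g])
      show "T \<subseteq> (Q \<times> A) \<times> (Q \<times> A)" by (auto simp: T_def Z_def)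
      show "g z z' \<in> XX \<times> XX" if "(z, z') \<in> T" for z z'
        using that inXq by (auto simp: g_def T_def Z_def)
      show "b = b'" if "((q, b), (q, b')) \<in> T" for q b b'
        using T[OF that] Q2 by (intro cancel[of "q - 1"]) auto
      show "\<exists>u v. coprime u p \<and> coprime v p \<and> (\<forall>q b q' b'. ((q, b), (q', b')) \<in> T \<longrightarrow>
          g (q, b) (q', b') = y \<longrightarrow> [q * u = q' * v] (mod p))" if y: "y \<in> XX \<times> XX" for y
      \<comment> \<open>The components of the label are interchanged: multiplying
        \<open>(q - 1)! b \<equiv> (q' - 1)! b'\<close> by \<open>q q'\<close> pairs
        \<open>q\<close> with the product built from \<open>q'\<close>, and conversely.\<close>
      proof (rule exI[of _ "snd y"], rule exI[of _ "fst y"], intro conjI allI impI)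
        fix q b q' b' assume t: "((q, b), (q', b')) \<in> T" and gy: "g (q, b) (q', b') = y"
        have "[q * snd y = q * (fact q' * b')] (mod p)"
          using gy by (auto simp: g_def cong_def mod_mult_right_eq)
        also have "q * (fact q' * b') = q * q' * (fact (q' - 1) * b')"
          using fact_q[OF T(2)[OF t]] by simp
        also have "[q * q' * (fact (q' - 1) * b') = q * q' * (fact (q - 1) * b)] (mod p)"
          by (rule cong_mult[OF cong_refl cong_sym[OF T(5)[OF t]]])
        also have "q * q' * (fact (q - 1) * b) = q' * (fact q * b)"
          using fact_q[OF T(1)[OF t]] by simp
        also have "[q' * (fact q * b) = q' * fst y] (mod p)"
          using gy by (auto simp: g_def cong_def mod_mult_right_eq)
        finally show "[q * snd y = q' * fst y] (mod p)" .
      qed (use y copX in auto)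
      show "b = c \<and> b' = c'"
        if t: "((q, b), (q', b')) \<in> T" "((q, c), (q', c')) \<in> T"
          and e: "g (q, b) (q', b') = g (q, c) (q', c')" for q b q' b' c c'
        using T[OF t(1)] T[OF t(2)] e Q2
        by (intro conjI cancel[of q] cancel[of q']) (auto simp: g_def cong_def)
    qed (use p finA finX Q_def in auto)
    finally show ?thesis
      using cardZ by (simp add: card_cartesian_product X_def XX_def mult_left_mono power2_eq_square)
  qed
  show ?thesis
  proof (cases "P \<le> 2 * X")
    case False
    \<comment> \<open>With \<open>2 * X < P\<close> the diagonal term is at most half of the left
      side in both inequalities; moving it over doubles 6 to 12.\<close>
    then have XP: "2 * X < P" by simp
    then have "X * P \<le> P ^ 2 / 2" using mult_right_mono[of "2 * X" P P] P0 by (simp add: power2_eq_square)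
    then have J1: "P ^ 2 \<le> 12 * K * a * X" using I1 by (simp add: algebra_simps)
    have "P \<le> P * a" using mult_left_mono[of 1 a P] a1 P0 by simp
    then have "X * (P * a) \<le> (P / 2 * a) * (P * a)"
      using XP a1 P0 by (intro mult_right_mono) auto
    then have J2: "(P * a) ^ 2 \<le> 12 * K * X ^ 3"
      using I2 by (simp add: algebra_simps power2_eq_square power3_eq_cube)
    \<comment> \<open>Squaring \<open>J1\<close> produces \<open>a ^ 2\<close>, which combines with
      the remaining \<open>P ^ 2\<close> into the left side of \<open>J2\<close>. The constant is
      \<open>12 ^ 3\<close>.\<close>
    have "P ^ 6 = (P ^ 2) ^ 2 * P ^ 2" by (simp flip: power_mult power_add)
    also have "\<dots> \<le> (12 * K * a * X) ^ 2 * P ^ 2"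
      using J1 by (intro mult_right_mono power_mono) auto
    also have "\<dots> = (12 * K * X) ^ 2 * (P * a) ^ 2" by (simp add: power_mult_distrib)
    also have "\<dots> \<le> (12 * K * X) ^ 2 * (12 * K * X ^ 3)" using J2 by (intro mult_left_mono) auto
    also have "\<dots> = 1728 * K ^ 3 * X ^ 5" by (simp add: power_mult_distrib eval_nat_numeral)
    finally show ?thesis by simp
  qed simp
qed

section \<open>From the dichotomy to the exponent \<open>1 - \<epsilon>\<close>\<close>

theorem theorem4:
  shows "\<exists>p0::nat. \<forall>\<epsilon>::real. \<epsilon> > 0 \<longrightarrow>
    (\<exists>c::real. c > 0 \<and>
      (\<forall>p N :: nat. prime p \<longrightarrow> p \<ge> p0 \<longrightarrow> N > 0 \<longrightarrow> real N < real p powr (3 / 5) \<longrightarrow>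
        real (card (factorial_products p N)) \<ge> c * real N powr (1 - \<epsilon>)))"
proof (intro exI[of _ "0::nat"] allI impI)
  fix \<epsilon> :: real assume "\<epsilon> > 0"
  \<comment> \<open>Half of \<open>\<epsilon>\<close> suffices because
    \<open>5 * (1 - 2 * \<delta>) \<le> 6 * (1 - \<delta>) - 1\<close>, the exponent comparison for
    the second alternative.\<close>
  define \<delta> where "\<delta> = min 1 (\<epsilon> / 2)"
  have \<delta>: "0 < \<delta>" "\<delta> \<le> 1" "2 * \<delta> \<le> \<epsilon>" using \<open>\<epsilon> > 0\<close> by (auto simp: \<delta>_def)
  obtain d where d: "0 < d" "d \<le> 1"
    "\<And>n. n \<ge> 2 \<Longrightarrow> d * real n powr (1 - \<delta>) \<le> real (card {q::nat. prime q \<and> q \<le> n})"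
    using card_primes_ge_powr[OF \<delta>(1,2)] by blast
  \<comment> \<open>Chosen to satisfy three demands: \<open>c \<le> 1\<close> for
    \<open>N = 1\<close>, \<open>c \<le> d / 2\<close> for the first alternative, and
    \<open>c ^ 5 \<le> d ^ 6 / 1728\<close> for the second.\<close>
  define c where "c = d ^ 2 / 1728"
  have "d ^ 2 \<le> d" using d mult_left_mono[of d 1 d] by (simp add: power2_eq_square)
  then have cd: "c \<le> d / 2" "c \<le> 1" using d unfolding c_def by linarith+
  have c5: "c ^ 5 \<le> d ^ 6 / 1728"
  proof -
    have "d ^ 10 \<le> d ^ 6" using d by (intro power_decreasing) auto
    then have "d ^ 10 / 1728 ^ 5 \<le> d ^ 6 / 1728" using d by (intro frac_le) auto
    then show ?thesis by (simp add: c_def power_divide flip: power_mult)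
  qed
  show "\<exists>c>0. \<forall>p N::nat. prime p \<longrightarrow> p \<ge> 0 \<longrightarrow> N > 0 \<longrightarrow> real N < real p powr (3 / 5) \<longrightarrow>
        real (card (factorial_products p N)) \<ge> c * real N powr (1 - \<epsilon>)"
  proof (intro exI[of _ c] conjI allI impI)
    show "c > 0" using d by (simp add: c_def)
    fix p N :: nat
    assume p: "prime p" and N0: "N > 0" and N: "real N < real p powr (3 / 5)"
    define X where "X = real (card (factorial_products p N))"
    have p1: "real p > 1" using prime_gt_1_nat[OF p] by simp
    have "real p powr (3 / 5) \<le> real p powr 1" using p1 by (intro powr_mono) auto
    then have Np: "N < p" using N p1 by simp
    have mono: "real N powr (1 - \<epsilon>) \<le> real N powr (1 - 2 * \<delta>)"
      "real N powr (1 - 2 * \<delta>) \<le> real N powr (1 - \<delta>)"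
      using N0 \<delta> by (auto intro!: powr_mono)
    have "c * real N powr (1 - \<epsilon>) \<le> X"
    proof (cases "N \<ge> 2")
      case False
      then have [simp]: "N = 1" using N0 by simp
      have "factorial_products p N = {1}" using Np by (auto simp: factorial_products_def)
      then show ?thesis using cd by (simp add: X_def)
    next
      case True
      define P where "P = real (card {q. prime q \<and> q \<le> N})"
      define K where "K = max 1 (real N ^ 2 / real p)"
      have dP: "d * real N powr (1 - \<delta>) \<le> P" using d(3)[OF True] by (simp add: P_def)
      \<comment> \<open>This is where the exponent 3/5 enters: \<open>N ^ 5 \<le> p ^ 3\<close> says
        that \<open>N ^ 6 / p ^ 3 \<le> N\<close>, so that \<open>K ^ 3\<close> costs at most one
        factor \<open>N\<close>.\<close>
      have N5: "real N ^ 5 \<le> real p ^ 3"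
      proof -
        have "real N ^ 5 \<le> (real p powr (3 / 5)) ^ 5" using N by (intro power_mono) auto
        also have "\<dots> = real p powr 3" using p1 by (simp add: powr_power)
        finally show ?thesis using p1 by simp
      qed
      have "(real N ^ 2 / real p) ^ 3 = real N * real N ^ 5 / real p ^ 3"
        by (simp add: power_divide flip: power_mult power_Suc)
      also have "\<dots> \<le> real N" using N5 p1 by (simp add: divide_le_eq mult_left_mono)
      finally have K3: "K ^ 3 \<le> real N" using N0 by (auto simp: K_def max_def)
      consider "P \<le> 2 * X" | "P ^ 6 \<le> 1728 * K ^ 3 * X ^ 5"
        using factorial_products_dichotomy[OF p N0 Np] unfolding P_def K_def X_def by blast
      then show ?thesis
      proof cases
        case 1
        have "c * real N powr (1 - \<epsilon>) \<le> d / 2 * real N powr (1 - \<delta>)"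
          using cd mono d by (intro mult_mono) auto
        then show ?thesis using 1 dP by simp
      next
        case 2
        \<comment> \<open>Fifth powers are compared, since the second alternative with
          \<open>K ^ 3 \<le> N\<close> bounds \<open>X ^ 5\<close> below by
          \<open>P ^ 6 / (1728 * N)\<close>.\<close>
        have "(c * real N powr (1 - \<epsilon>)) ^ 5 \<le> (c * real N powr (1 - 2 * \<delta>)) ^ 5"
          using mono d by (intro power_mono mult_left_mono) (auto simp: c_def)
        also have "\<dots> \<le> d ^ 6 / 1728 * (real N powr (1 - 2 * \<delta>)) ^ 5"
          unfolding power_mult_distrib using c5 by (intro mult_right_mono) auto
        also have "(real N powr (1 - 2 * \<delta>)) ^ 5 = real N powr (5 * (1 - 2 * \<delta>))"
          using N0 by (simp add: powr_power mult.commute)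
        also have "\<dots> \<le> real N powr (6 * (1 - \<delta>) - 1)" using N0 \<delta> by (intro powr_mono) auto
        also have "\<dots> = (real N powr (1 - \<delta>)) ^ 6 / real N"
          using N0 powr_diff[of "real N" "6 * (1 - \<delta>)" 1] powr_power[of "real N" "1 - \<delta>" 6]
          by (simp only: mult.commute of_nat_numeral powr_one)
        finally have "(c * real N powr (1 - \<epsilon>)) ^ 5 \<le> (d * real N powr (1 - \<delta>)) ^ 6 / (1728 * real N)"
          using d by (simp add: power_mult_distrib mult_left_mono)
        also have "\<dots> \<le> P ^ 6 / (1728 * real N)"
          using dP d by (intro divide_right_mono power_mono) auto
        also have "\<dots> \<le> X ^ 5"
        proof -
          have "P ^ 6 \<le> 1728 * real N * X ^ 5"
            using 2 K3 by (smt (verit) X_def mult_left_mono mult_right_mono of_nat_0_le_iff zero_le_power)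
          then show ?thesis using N0 by (simp add: field_simps)
        qed
        finally show ?thesis
          by (rule power_le_imp_le_base[of _ 4, simplified]) (simp add: X_def)
      qed
    qed
    then show "c * real N powr (1 - \<epsilon>) \<le> real (card (factorial_products p N))"
      by (simp add: X_def)
  qed
qed

end
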